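(* Let $A\in\mathbb{R}^{n\times n}$ be symmetric positive definite with all eigenvalues in $[a,b]$, where $0<a<b$. Let $0<\varepsilon\le1$, $p\ge1$, $q=p/2$, and $\kappa=\sqrt{b/a}$. Let $\psi_N$ be the degree-$N$ Chebyshev approximation of $x^{p/2}$ on $[a,b]$ and let $\phi_N(A)=[\psi_N(A)]^2$. If the degree $N$ satisfies $$N\ \ge\ \frac{\log\left(\frac{4}{\varepsilon}(\kappa^2+1)^q(\kappa-1)\left(\kappa^p+\sqrt{\frac{\varepsilon}{2}+\kappa^{2p}}\right)\right)}{\log\left(\frac{\kappa+1}{\kappa-1}\right)},$$ then $$\big|\operatorname{tr}(\phi_N(A))-\|A\|_{S_p}^p\big|\ \le\ \frac{\varepsilon}{2}\,\|A\|_{S_p}^p .$$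
   Context: For a symmetric positive semidefinite matrix $A\in\mathbb{R}^{n\times n}$ with eigenvalues $\lambda_1,\dots,\lambda_n\ge0$ and $p\ge1$, the Schatten $p$-norm is $\|A\|_{S_p}=\big(\sum_{j=1}^n\lambda_j^p\big)^{1/p}=(\operatorname{tr}(A^p))^{1/p}$. Chebyshev approximation: $T_j(x)=\cos(j\arccos x)$, $x\in[-1,1]$, is the $j$th Chebyshev polynomial of the first kind. The degree-$N$ Chebyshev approximation of $g(x)=x^{p/2}$ on $[a,b]$ is the truncated Chebyshev series $$\psi_N(x)=c_0+\sum_{j=1}^N c_j\,T_j\Big(\frac{2}{b-a}x-\frac{b+a}{b-a}\Big),$$ where $c_j=\frac2\pi\int_0^\pi g\big(\tfrac{b-a}{2}\cos\theta+\tfrac{b+a}{2}\big)\cos(j\theta)\,d\theta$ for $j\ge1$ and $c_0=\frac1\pi\int_0^\pi g\big(\tfrac{b-a}{2}\cos\theta+\tfrac{b+a}{2}\big)\,d\theta$. The polynomials $\psi_N$ and $\phi_N=\psi_N^2$ are applied to matrices as matrix polynomials. *)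

theory Defs
  imports
    "HOL-Analysis.Analysis"
    "Jordan_Normal_Form.Char_Poly"
begin

text \<open>Matrices are those of Jordan_Normal_Form, with the size \<open>n\<close> given by a carrier set.
  HOL-Analysis reuses several of its names and symbols (\<open>vec\<close>, the infix scalar product, ...),
  so the full names are used below.\<close>

definition mat_trace :: "'a :: comm_monoid_add Matrix.mat \<Rightarrow> 'a" where
  "mat_trace A = (\<Sum>i<dim_row A. A $$ (i, i))"

definition symmetric_positive_definite :: "real Matrix.mat \<Rightarrow> bool" where
  "symmetric_positive_definite A \<longleftrightarrow>
     square_mat A \<and> transpose_mat A = A \<and>
     (\<forall>v \<in> carrier_vec (dim_row A). v \<noteq> 0\<^sub>v (dim_row A) \<longrightarrow> Matrix.scalar_prod v (A *\<^sub>v v) > 0)"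

text \<open>The matrix \<open>p(A) = \<Sum>k. p\<^sub>k A\<^sup>k\<close>, given by its entries.\<close>

definition poly_mat :: "'a :: comm_semiring_1 poly \<Rightarrow> 'a Matrix.mat \<Rightarrow> 'a Matrix.mat" where
  "poly_mat p A = Matrix.mat (dim_row A) (dim_row A)
     (\<lambda>(i, j). \<Sum>k\<le>degree p. coeff p k * (A ^\<^sub>m k) $$ (i, j))"

text \<open>Only meant for symmetric positive semidefinite matrices. Their characteristic polynomial
  splits over the reals, so \<open>proots\<close> lists all \<open>n\<close> eigenvalues with multiplicity.\<close>

definition schatten_norm :: "real \<Rightarrow> real Matrix.mat \<Rightarrow> real" where
  "schatten_norm p A = (\<Sum>\<mu>\<in>#proots (char_poly A). \<mu> powr p) powr (1 / p)"

lemma cheb_poly_exists: "\<exists>P :: real poly. \<forall>x\<in>{-1..1}. poly P x = cos (real j * arccos x)"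
proof (induction j rule: less_induct)
  case (less j)
  consider "j = 0" | "j = 1" | i where "j = Suc (Suc i)"
    by (metis One_nat_def not0_implies_Suc)
  then show ?case
  proof cases
    case 1
    then show ?thesis by (intro exI[of _ 1]) auto
  next
    case 2
    then show ?thesis by (intro exI[of _ "[:0, 1:]"]) (auto simp: cos_arccos)
  next
    case 3
    obtain P where P: "\<forall>x\<in>{-1..1::real}. poly P x = cos (real i * arccos x)"
      using less 3 by force
    obtain Q where Q: "\<forall>x\<in>{-1..1::real}. poly Q x = cos (real (Suc i) * arccos x)"
      using less 3 by blast
    have "poly ([:0, 2:] * Q - P) x = cos (real j * arccos x)" if x: "x \<in> {-1..1}" for x
    proof -
      define t where "t = arccos x"
      have c: "cos t = x" using x by (simp add: t_def)
      have "cos (real (Suc i) * t + t) + cos (real (Suc i) * t - t) = 2 * cos t * cos (real (Suc i) * t)"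
        by (simp add: cos_add cos_diff)
      moreover have "real (Suc i) * t + t = real j * t" "real (Suc i) * t - t = real i * t"
        using 3 by (simp_all add: algebra_simps)
      ultimately have "2 * x * cos (real (Suc i) * t) - cos (real i * t) = cos (real j * t)"
        using c by simp
      then show ?thesis using P Q x by (simp add: t_def algebra_simps)
    qed
    then show ?thesis by blast
  qed
qed

lemma cheb_poly_ex1: "\<exists>!P :: real poly. \<forall>x\<in>{-1..1}. poly P x = cos (real j * arccos x)"
proof (rule ex_ex1I[OF cheb_poly_exists])
  fix P Q :: "real poly"
  assume P: "\<forall>x\<in>{-1..1}. poly P x = cos (real j * arccos x)"
    and Q: "\<forall>x\<in>{-1..1}. poly Q x = cos (real j * arccos x)"
  have "{-1..1} \<subseteq> {x. poly (P - Q) x = 0}" using P Q by auto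
  moreover have "infinite {-1..1::real}" by (simp add: infinite_Icc)
  ultimately have "infinite {x. poly (P - Q) x = 0}" using finite_subset by blast
  then have "P - Q = 0" using poly_roots_finite by blast
  then show "P = Q" by simp
qed

definition cheb_poly :: "nat \<Rightarrow> real poly" where
  "cheb_poly j = (THE P. \<forall>x\<in>{-1..1}. poly P x = cos (real j * arccos x))"

lemma poly_cheb_poly: "x \<in> {-1..1} \<Longrightarrow> poly (cheb_poly j) x = cos (real j * arccos x)"
  using theI'[OF cheb_poly_ex1[of j]] unfolding cheb_poly_def by blast

definition cheb_coeff :: "(real \<Rightarrow> real) \<Rightarrow> real \<Rightarrow> real \<Rightarrow> nat \<Rightarrow> real" where
  "cheb_coeff g a b j = (if j = 0 then 1 / pi else 2 / pi) *
     integral {0..pi} (\<lambda>\<theta>. g ((b - a) / 2 * cos \<theta> + (b + a) / 2) * cos (real j * \<theta>))"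

definition cheb_approx :: "nat \<Rightarrow> (real \<Rightarrow> real) \<Rightarrow> real \<Rightarrow> real \<Rightarrow> real poly" where
  "cheb_approx N g a b =
     [: cheb_coeff g a b 0 :] +
     (\<Sum>j=1..N. Polynomial.smult (cheb_coeff g a b j)
        (pcompose (cheb_poly j) [: - ((b + a) / (b - a)), 2 / (b - a) :]))"

end

theory Submission
  imports Defs "Jordan_Normal_Form.Schur_Decomposition"
begin

text \<open>Put \<open>t = (\<kappa> - 1) / (\<kappa> + 1)\<close>. For \<open>x = (b - a) / 2 * cos \<theta> + (b + a) / 2\<close> one has
  \<open>x = a / (1 - t)\<^sup>2 * \<bar>1 + t e\<^sup>i\<^sup>\<theta>\<bar>\<^sup>2\<close>, so \<open>x\<^sup>q\<close> is a constant times the squared modulus of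
  the binomial series \<open>\<Sum>m. (q choose m) t\<^sup>m e\<^sup>i\<^sup>m\<^sup>\<theta>\<close>. This replaces the usual contour integral over
  the Bernstein ellipse: truncating the Chebyshev series drops exactly the products of terms \<open>m\<close>, \<open>n\<close>
  with \<open>\<bar>m - n\<bar> > N\<close>. Their sum is estimated by \<open>\<bar>q choose m\<bar> \<le> 2\<^sup>q\<close> and
  \<open>\<Sum>m. \<bar>q choose m\<bar> u\<^sup>m \<le> (1 - u)\<^sup>-\<^sup>q\<close> with \<open>u = t\<^sup>2\<close>. The last factor is worse than in the classical
  bound, but the factor \<open>\<kappa>\<^sup>p + sqrt (\<epsilon> / 2 + \<kappa>\<^sup>2\<^sup>p)\<close> in the assumption on \<open>N\<close> absorbs it. This gives
  a relative error of at most \<open>\<epsilon> / 2\<close> for each eigenvalue, and a Schur triangularisation of \<open>A\<close> turns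
  both sides of the claim into sums over the eigenvalues.\<close>

section \<open>Bounds for real binomial coefficients\<close>

text \<open>For an upper index in [0, 1] every factor (r - m) / (m + 1) of the recursion in m has
  modulus at most 1, which gives the bound 1. Pascal's rule then raises the upper index by one at
  the cost of at most doubling the bound; this happens floor(q) times.\<close>

lemma abs_gbinomial_le_two_powr:
  fixes q :: real
  assumes "0 \<le> q"
  shows "\<bar>q gchoose m\<bar> \<le> 2 powr q"
proof -
  have base: "\<bar>r gchoose m\<bar> \<le> 1" if "0 \<le> r" "r \<le> 1" for r :: real and m
  proof (induction m)
    case (Suc m)
    have "r gchoose Suc m = (r gchoose m) * ((r - real m) / real (Suc m))"
      using gbinomial_mult_1'[of r m] by (simp add: field_simps)
    moreover have "\<bar>(r - real m) / real (Suc m)\<bar> \<le> 1"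
      using that by (simp add: field_simps)
    ultimately show ?case
      using Suc by (simp only: abs_mult mult_le_one abs_ge_zero)
  qed simp
  have step: "\<bar>r gchoose m\<bar> \<le> 2 ^ k" if "real k \<le> r" "r \<le> real k + 1" for r :: real and k m
    using that
  proof (induction k arbitrary: r m)
    case 0
    then show ?case using base by simp
  next
    case (Suc k)
    show ?case
    proof (cases m)
      case 0
      then show ?thesis using one_le_power[of "2::real" "Suc k"] by simp
    next
      case (Suc l)
      have "r gchoose Suc l = ((r - 1) gchoose l) + ((r - 1) gchoose Suc l)"
        using gbinomial_Suc_Suc[of "r - 1" l] by simp
      moreover have "\<bar>(r - 1) gchoose l\<bar> \<le> 2 ^ k" "\<bar>(r - 1) gchoose Suc l\<bar> \<le> 2 ^ k"
        using Suc.IH[of "r - 1"] Suc.prems by auto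
      ultimately show ?thesis using Suc by simp
    qed
  qed
  define k where "k = nat \<lfloor>q\<rfloor>"
  have k: "real k \<le> q" "q \<le> real k + 1"
    using assms unfolding k_def by linarith+
  have "\<bar>q gchoose m\<bar> \<le> 2 powr real k"
    using step[OF k] by (simp add: powr_realpow)
  also have "\<dots> \<le> 2 powr q" using k by simp
  finally show ?thesis .
qed

text \<open>From |q - i| \<le> q + i in each factor, |q choose m| is at most (-1)^m (-q choose m),
  the mth coefficient of (1 - u)^(-q). These coefficients are nonnegative, so partial sums stay
  below the value of the series.\<close>

lemma sum_abs_gbinomial_le:
  fixes q u :: real
  assumes q: "0 \<le> q" and u: "0 \<le> u" "u < 1"
  shows "(\<Sum>m<M. \<bar>q gchoose m\<bar> * u ^ m) \<le> (1 - u) powr (- q)"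
proof -
  have le: "\<bar>q gchoose m\<bar> \<le> (- q gchoose m) * (- 1) ^ m" for m
  proof -
    have "\<bar>q gchoose m\<bar> = (\<Prod>i = 0..<m. \<bar>q - real i\<bar>) / fact m"
      by (simp add: gbinomial_prod_rev abs_prod)
    also have "\<dots> \<le> (\<Prod>i = 0..<m. q + real i) / fact m"
      using q by (intro divide_right_mono prod_mono) auto
    also have "\<dots> = (- q gchoose m) * (- 1) ^ m"
      by (simp add: gbinomial_pochhammer pochhammer_prod power_mult_distrib flip: power_add mult_2)
    finally show ?thesis .
  qed
  have s: "(\<lambda>m. (- q gchoose m) * (- 1) ^ m * u ^ m) sums (1 - u) powr (- q)"
    using gen_binomial_real[of "- u" "- q"] u by (simp add: power_minus[of u] mult.assoc)
  have nonneg: "0 \<le> (- q gchoose m) * (- 1) ^ m * u ^ m" for m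
    using order_trans[OF abs_ge_zero le[of m]] u by simp
  have "(\<Sum>m<M. \<bar>q gchoose m\<bar> * u ^ m) \<le> (\<Sum>m<M. (- q gchoose m) * (- 1) ^ m * u ^ m)"
    using le u by (intro sum_mono mult_right_mono) auto
  also have "\<dots> \<le> (1 - u) powr (- q)"
    using sum_le_suminf[OF sums_summable[OF s], of "{..<M}"] nonneg sums_unique[OF s] by simp
  finally show ?thesis .
qed

section \<open>Cosine series and their truncation\<close>

text \<open>The Fourier cosine coefficients of the even extension of \<open>h\<close>. With g
  composed with the affine image of cos in place of \<open>h\<close>, they are the Chebyshev
  coefficients of g.\<close>

definition cos_coeff :: "(real \<Rightarrow> real) \<Rightarrow> nat \<Rightarrow> real" where
  "cos_coeff h j = (if j = 0 then 1 / pi else 2 / pi) * integral {0..pi} (\<lambda>\<theta>. h \<theta> * cos (real j * \<theta>))"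

definition cos_trunc :: "nat \<Rightarrow> (real \<Rightarrow> real) \<Rightarrow> real \<Rightarrow> real" where
  "cos_trunc N h \<theta> = (\<Sum>j\<le>N. cos_coeff h j * cos (real j * \<theta>))"

text \<open>The frequency is an integer because the product formula for cosines produces differences
  k - j of either sign.\<close>

lemma has_integral_cos_int:
  fixes k :: int
  shows "((\<lambda>\<theta>. cos (of_int k * \<theta>)) has_integral (if k = 0 then pi else 0)) {0..pi}"
proof (cases "k = 0")
  case True
  then show ?thesis using has_integral_const_real[of "1::real" 0 pi] by simp
next
  case False
  have "((\<lambda>\<theta>. cos (of_int k * \<theta>)) has_integral
      sin (of_int k * pi) / of_int k - sin (of_int k * 0) / of_int k) {0..pi}"
    using False
    by (intro fundamental_theorem_of_calculus)
       (auto intro!: derivative_eq_intros simp flip: has_real_derivative_iff_has_vector_derivative)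
  then show ?thesis using False by (simp add: sin_int_times_real mult.commute)
qed

lemma cos_coeff_cos: "cos_coeff (\<lambda>\<theta>. cos (real k * \<theta>)) j = (if j = k then 1 else 0)"
proof -
  have eq: "cos (real k * \<theta>) * cos (real j * \<theta>) =
      (cos (of_int (int k - int j) * \<theta>) + cos (of_int (int k + int j) * \<theta>)) / 2" for \<theta>
    by (simp add: cos_times_cos left_diff_distrib distrib_right)
  \<comment> \<open>For j = k = 0 both cosines are constant and the integral is pi instead of pi /
    2; the separate normalisation 1 / pi in \<open>cos_coeff\<close> compensates for this.\<close>
  have "((\<lambda>\<theta>. cos (real k * \<theta>) * cos (real j * \<theta>)) has_integral
     ((if int k - int j = 0 then pi else 0) + (if int k + int j = 0 then pi else 0)) / 2) {0..pi}"
    unfolding eq by (intro has_integral_divide has_integral_add has_integral_cos_int)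
  then have "integral {0..pi} (\<lambda>\<theta>. cos (real k * \<theta>) * cos (real j * \<theta>)) =
     ((if int k - int j = 0 then pi else 0) + (if int k + int j = 0 then pi else 0)) / 2"
    by (rule integral_unique)
  then show ?thesis
    by (auto simp: cos_coeff_def)
qed

lemma cos_coeff_sum:
  assumes "finite I" "\<And>i. i \<in> I \<Longrightarrow> continuous_on {0..pi} (f i)"
  shows "cos_coeff (\<lambda>\<theta>. \<Sum>i\<in>I. w i * f i \<theta>) j = (\<Sum>i\<in>I. w i * cos_coeff (f i) j)"
proof -
  have "integral {0..pi} (\<lambda>\<theta>. \<Sum>i\<in>I. w i * (f i \<theta> * cos (real j * \<theta>))) =
      (\<Sum>i\<in>I. integral {0..pi} (\<lambda>\<theta>. w i * (f i \<theta> * cos (real j * \<theta>))))"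
    using assms
    by (intro integral_sum integrable_continuous_real continuous_intros) auto
  then show ?thesis
    by (simp add: cos_coeff_def sum_distrib_right sum_distrib_left mult.assoc mult.left_commute)
qed

text \<open>By orthogonality, each cosine survives truncation whole or not at all. The frequencies
  \<open>d i\<close> may repeat, as they do when the indices are pairs (m, n) with frequency |m -
  n|.\<close>

lemma cos_trunc_cos_sum:
  fixes w :: "'i \<Rightarrow> real" and d :: "'i \<Rightarrow> nat"
  assumes "finite I"
  shows "cos_trunc N (\<lambda>\<theta>. \<Sum>i\<in>I. w i * cos (real (d i) * \<theta>)) \<theta> =
    (\<Sum>i\<in>I. if d i \<le> N then w i * cos (real (d i) * \<theta>) else 0)"
proof -
  have "cos_trunc N (\<lambda>\<theta>. \<Sum>i\<in>I. w i * cos (real (d i) * \<theta>)) \<theta> =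
     (\<Sum>j\<le>N. \<Sum>i\<in>I. if j = d i then w i * cos (real j * \<theta>) else 0)"
    unfolding cos_trunc_def
    by (subst cos_coeff_sum)
       (auto simp: assms cos_coeff_cos sum_distrib_right intro!: continuous_intros sum.cong)
  also have "\<dots> = (\<Sum>i\<in>I. \<Sum>j\<le>N. if j = d i then w i * cos (real j * \<theta>) else 0)"
    by (rule sum.swap)
  finally show ?thesis by simp
qed

lemma cos_trunc_error_cos_sum:
  fixes w :: "'i \<Rightarrow> real" and d :: "'i \<Rightarrow> nat"
  assumes "finite I"
  shows "\<bar>(\<Sum>i\<in>I. w i * cos (real (d i) * \<theta>)) - cos_trunc N (\<lambda>\<theta>. \<Sum>i\<in>I. w i * cos (real (d i) * \<theta>)) \<theta>\<bar>
    \<le> (\<Sum>i | i \<in> I \<and> N < d i. \<bar>w i\<bar>)"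
proof -
  have "(\<Sum>i\<in>I. w i * cos (real (d i) * \<theta>)) - cos_trunc N (\<lambda>\<theta>. \<Sum>i\<in>I. w i * cos (real (d i) * \<theta>)) \<theta> =
      (\<Sum>i\<in>I. if N < d i then w i * cos (real (d i) * \<theta>) else 0)"
    unfolding cos_trunc_cos_sum[OF assms] by (auto simp flip: sum_subtractf intro!: sum.cong)
  also have "\<bar>\<dots>\<bar> \<le> (\<Sum>i\<in>I. if N < d i then \<bar>w i\<bar> else 0)"
    by (rule order_trans[OF sum_abs sum_mono]) (auto simp: abs_mult mult_left_le)
  also have "\<dots> = (\<Sum>i | i \<in> I \<and> N < d i. \<bar>w i\<bar>)"
    by (simp add: assms sum.inter_filter)
  finally show ?thesis .
qed

section \<open>Truncation error for squared moduli of power series on a circle\<close>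

text \<open>Adding the squares of real and imaginary parts pairs the products into cos((m - n)
  \<theta>). Since cos is even, |m - n| can serve as a natural frequency, the form that
  \<open>cos_trunc_cos_sum\<close> takes.\<close>

lemma cmod_cis_sum_squared:
  fixes a :: "nat \<Rightarrow> real"
  shows "(cmod (\<Sum>m<M. of_real (a m) * cis (real m * \<theta>)))\<^sup>2 =
    (\<Sum>(m, n)\<in>{..<M} \<times> {..<M}. a m * a n * cos (real (nat \<bar>int m - int n\<bar>) * \<theta>))"
proof -
  have c: "cos (real m * \<theta>) * cos (real n * \<theta>) + sin (real m * \<theta>) * sin (real n * \<theta>) =
      cos (real (nat \<bar>int m - int n\<bar>) * \<theta>)" for m n
  proof -
    have "real (nat \<bar>int m - int n\<bar>) * \<theta> = real m * \<theta> - real n * \<theta> \<or>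
       real (nat \<bar>int m - int n\<bar>) * \<theta> = real n * \<theta> - real m * \<theta>"
      by (auto simp: abs_if algebra_simps)
    then show ?thesis by (auto simp: cos_diff)
  qed
  have "(cmod (\<Sum>m<M. of_real (a m) * cis (real m * \<theta>)))\<^sup>2 =
     (\<Sum>m<M. a m * cos (real m * \<theta>))\<^sup>2 + (\<Sum>m<M. a m * sin (real m * \<theta>))\<^sup>2"
    by (simp add: cmod_power2 Re_sum Im_sum)
  also have "\<dots> = (\<Sum>m<M. \<Sum>n<M. a m * a n *
      (cos (real m * \<theta>) * cos (real n * \<theta>) + sin (real m * \<theta>) * sin (real n * \<theta>)))"
    by (simp add: power2_eq_square sum_product distrib_left sum.distrib mult_ac)
  finally show ?thesis by (simp add: c sum.cartesian_product)
qed

text \<open>By symmetry it suffices to treat n > m + N and double. Bounding |a n| by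
  \<open>C\<close> leaves a geometric tail in n starting at t^(m + N + 1); its factor t^m joins the
  t^m already present, hence the powers of t^2.\<close>

lemma sum_far_pairs_le:
  fixes a :: "nat \<Rightarrow> real" and C t :: real
  assumes t: "0 \<le> t" "t < 1" and C: "\<And>m. \<bar>a m\<bar> \<le> C"
  shows "(\<Sum>(m, n) | (m, n) \<in> {..<M} \<times> {..<M} \<and> N < nat \<bar>int m - int n\<bar>. \<bar>a m * t ^ m * (a n * t ^ n)\<bar>)
    \<le> 2 * C * (\<Sum>m<M. \<bar>a m\<bar> * (t\<^sup>2) ^ m) * t ^ (N + 1) / (1 - t)"
proof -
  let ?w = "\<lambda>m n. \<bar>a m\<bar> * t ^ m * (\<bar>a n\<bar> * t ^ n)"
  let ?B = "C * (\<Sum>m<M. \<bar>a m\<bar> * (t\<^sup>2) ^ m) * t ^ (N + 1) / (1 - t)"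
  have C0: "0 \<le> C" using C[of 0] by linarith
  have row: "(\<Sum>n | n < M \<and> m + N < n. t ^ n) \<le> t ^ (m + (N + 1)) / (1 - t)" for m
  proof -
    \<comment> \<open>The substitution n = m + N + 1 + k enlarges the range to all k < M, so that
      the sum is a multiple of a partial geometric sum.\<close>
    have "(\<Sum>n | n < M \<and> m + N < n. t ^ n) \<le> (\<Sum>n\<in>(+) (m + (N + 1)) ` {..<M}. t ^ n)"
    proof (rule sum_mono2)
      show "{n. n < M \<and> m + N < n} \<subseteq> (+) (m + (N + 1)) ` {..<M}"
      proof
        fix n assume "n \<in> {n. n < M \<and> m + N < n}"
        then show "n \<in> (+) (m + (N + 1)) ` {..<M}"
          by (intro image_eqI[where x = "n - (m + (N + 1))"]) auto
      qed
    qed (use t in auto)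
    also have "\<dots> = t ^ (m + (N + 1)) * (\<Sum>k<M. t ^ k)"
      by (subst sum.reindex) (auto simp: inj_on_def power_add sum_distrib_left mult_ac)
    also have "(\<Sum>k<M. t ^ k) \<le> (\<Sum>k. t ^ k)"
      using t by (intro sum_le_suminf summable_geometric) auto
    also have "(\<Sum>k. t ^ k) = 1 / (1 - t)" using t by (intro suminf_geometric) auto
    finally show ?thesis using t by (simp add: mult_left_mono)
  qed
  have upper: "(\<Sum>m<M. \<Sum>n | n < M \<and> m + N < n. ?w m n) \<le> ?B"
  proof -
    have "(\<Sum>m<M. \<Sum>n | n < M \<and> m + N < n. ?w m n) \<le>
        (\<Sum>m<M. \<Sum>n | n < M \<and> m + N < n. \<bar>a m\<bar> * t ^ m * (C * t ^ n))"
      using t C by (intro sum_mono mult_left_mono mult_right_mono) auto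
    also have "\<dots> = (\<Sum>m<M. \<bar>a m\<bar> * t ^ m * C * (\<Sum>n | n < M \<and> m + N < n. t ^ n))"
      by (simp add: sum_distrib_left mult.assoc)
    also have "\<dots> \<le> (\<Sum>m<M. \<bar>a m\<bar> * t ^ m * C * (t ^ (m + (N + 1)) / (1 - t)))"
      using t C0 by (intro sum_mono mult_left_mono row) auto
    also have "\<dots> = ?B"
      by (simp add: sum_distrib_left sum_distrib_right sum_divide_distrib power_add
          power2_eq_square power_mult_distrib mult_ac)
    finally show ?thesis .
  qed
  have "N < nat \<bar>int m - int n\<bar> \<longleftrightarrow> m + N < n \<or> n + N < m" for m n
    by linarith
  \<comment> \<open>The weight is symmetric. Writing it as \<open>?w n m\<close> in the second
    summand makes that double sum equal to the first after exchanging the summation order.\<close>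
  then have pair_split: "(if N < nat \<bar>int m - int n\<bar> then ?w m n else 0) =
      (if m + N < n then ?w m n else 0) + (if n + N < m then ?w n m else 0)" for m n
    by (simp add: mult.commute)
  have "(\<Sum>(m, n) | (m, n) \<in> {..<M} \<times> {..<M} \<and> N < nat \<bar>int m - int n\<bar>. \<bar>a m * t ^ m * (a n * t ^ n)\<bar>)
      = (\<Sum>(m, n)\<in>{i \<in> {..<M} \<times> {..<M}. N < nat \<bar>int (fst i) - int (snd i)\<bar>}. ?w m n)"
    using t by (intro sum.cong) (auto simp: abs_mult)
  also have "\<dots> = (\<Sum>(m, n)\<in>{..<M} \<times> {..<M}. if N < nat \<bar>int m - int n\<bar> then ?w m n else 0)"
    by (subst sum.inter_filter) (auto simp: case_prod_unfold intro!: sum.cong)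
  also have "\<dots> = (\<Sum>m<M. \<Sum>n<M. (if m + N < n then ?w m n else 0) + (if n + N < m then ?w n m else 0))"
    unfolding sum.cartesian_product[symmetric] by (intro sum.cong refl pair_split)
  also have "\<dots> = (\<Sum>m<M. \<Sum>n<M. if m + N < n then ?w m n else 0) + (\<Sum>m<M. \<Sum>n<M. if n + N < m then ?w n m else 0)"
    by (simp add: sum.distrib)
  also have "(\<Sum>m<M. \<Sum>n<M. if n + N < m then ?w n m else 0) = (\<Sum>m<M. \<Sum>n<M. if m + N < n then ?w m n else 0)"
    by (rule sum.swap)
  also have "(\<Sum>m<M. \<Sum>n<M. if m + N < n then ?w m n else 0) = (\<Sum>m<M. \<Sum>n | n < M \<and> m + N < n. ?w m n)"
    by (simp flip: sum.inter_filter)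
  finally show ?thesis using upper by simp
qed

text \<open>Both sides are |1 + t e^(i \<theta>)|^2. This form identifies the modulus of the limit
  and shows that the base of \<open>powr\<close> is nonnegative.\<close>

lemma one_add_cos_eq_sum_squares:
  fixes t \<theta> :: real
  shows "1 + 2 * t * cos \<theta> + t\<^sup>2 = (1 + t * cos \<theta>)\<^sup>2 + (t * sin \<theta>)\<^sup>2"
  unfolding power_mult_distrib sin_squared_eq by (simp add: power2_eq_square algebra_simps)

text \<open>The truncation is computed exactly for the squared modulus \<open>e M\<close> of the \<open>M\<close>th partial sum of the
  binomial series, and passes to the limit by dominated convergence.\<close>

lemma cos_trunc_error:
  fixes q t \<theta> :: real
  assumes q: "0 \<le> q" and t: "0 \<le> t" "t < 1" and \<theta>: "\<theta> \<in> {0..pi}"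
  defines "h \<equiv> \<lambda>\<theta>. (1 + 2 * t * cos \<theta> + t\<^sup>2) powr q"
  shows "\<bar>h \<theta> - cos_trunc N h \<theta>\<bar> \<le> 2 * 2 powr q * (1 - t\<^sup>2) powr (- q) * t ^ (N + 1) / (1 - t)"
proof -
  define a where "a m = q gchoose m" for m
  let ?I = "\<lambda>M. {..<M} \<times> {..<M}"
  \<comment> \<open>Expanding the squared modulus indexes its terms by pairs (m, n), with weight
    \<open>w\<close> and frequency \<open>d\<close>.\<close>
  define w where "w i = (case i of (m, n) \<Rightarrow> a m * t ^ m * (a n * t ^ n))" for i
  define d where "d i = (case i of (m, n) \<Rightarrow> nat \<bar>int m - int n\<bar>)" for i
  define e where "e M \<theta> = (\<Sum>i\<in>?I M. w i * cos (real (d i) * \<theta>))" for M \<theta>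
  let ?B = "2 * 2 powr q * (1 - t\<^sup>2) powr (- q) * t ^ (N + 1) / (1 - t)"
  have t2: "0 \<le> t\<^sup>2" "t\<^sup>2 < 1" using t by (auto simp: power_less_one_iff)
  have e_cmod: "e M \<theta> = (cmod (\<Sum>m<M. of_real (a m * t ^ m) * cis (real m * \<theta>)))\<^sup>2" for M \<theta>
    unfolding cmod_cis_sum_squared e_def w_def d_def by (simp add: case_prod_unfold)
  have lim: "(\<lambda>M. e M \<theta>) \<longlonglongrightarrow> h \<theta>" for \<theta>
  proof -
    let ?z = "of_real t * cis \<theta>"
    have nz: "norm ?z < 1" using t by (simp add: norm_mult)
    have "(\<lambda>m. (of_real q gchoose m) * ?z ^ m) sums (1 + ?z) powr of_real q"
      by (rule gen_binomial_complex[OF nz])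
    moreover have "(of_real q gchoose m) * ?z ^ m = of_real (a m * t ^ m) * cis (real m * \<theta>)" for m
      by (simp add: a_def power_mult_distrib Complex.DeMoivre gbinomial_prod_rev)
    ultimately have "(\<lambda>M. \<Sum>m<M. of_real (a m * t ^ m) * cis (real m * \<theta>)) \<longlonglongrightarrow> (1 + ?z) powr of_real q"
      by (simp add: sums_def)
    then have "(\<lambda>M. e M \<theta>) \<longlonglongrightarrow> (cmod ((1 + ?z) powr of_real q))\<^sup>2"
      unfolding e_cmod by (intro tendsto_intros)
    also have "cmod ((1 + ?z) powr of_real q) = cmod (1 + ?z) powr q"
      by (subst norm_powr_real_powr') simp_all
    also have "\<dots>\<^sup>2 = ((cmod (1 + ?z))\<^sup>2) powr q"
      by (simp add: power2_eq_square powr_mult)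
    also have "(cmod (1 + ?z))\<^sup>2 = 1 + 2 * t * cos \<theta> + t\<^sup>2"
      unfolding one_add_cos_eq_sum_squares by (simp add: cmod_power2)
    finally show ?thesis by (simp add: h_def)
  qed
  \<comment> \<open>A majorant independent of \<open>M\<close> and \<open>\<theta>\<close>, as
    dominated convergence requires.\<close>
  have e_bound: "\<bar>e M \<theta>\<bar> \<le> ((1 - t) powr (- q))\<^sup>2" for M \<theta>
  proof -
    have "cmod (\<Sum>m<M. of_real (a m * t ^ m) * cis (real m * \<theta>)) \<le> (\<Sum>m<M. \<bar>a m\<bar> * t ^ m)"
      by (rule sum_norm_le) (use t in \<open>simp add: norm_mult norm_power abs_mult\<close>)
    also have "\<dots> \<le> (1 - t) powr (- q)"
      unfolding a_def by (rule sum_abs_gbinomial_le[OF q t])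
    finally show ?thesis by (simp add: e_cmod power_mono)
  qed
  have e_cont: "continuous_on S (e M)" for S M
    unfolding e_def by (intro continuous_intros)
  have "(\<lambda>M. cos_coeff (e M) j) \<longlonglongrightarrow> cos_coeff h j" for j
    unfolding cos_coeff_def
  proof (intro tendsto_mult_left dominated_convergence(2))
    show "(\<lambda>\<theta>. e M \<theta> * cos (real j * \<theta>)) integrable_on {0..pi}" for M
      by (intro integrable_continuous_real continuous_intros e_cont)
    show "(\<lambda>\<theta>. ((1 - t) powr (- q))\<^sup>2) integrable_on {0..pi}"
      by (intro integrable_continuous_real continuous_on_const)
    show "norm (e M \<theta> * cos (real j * \<theta>)) \<le> ((1 - t) powr (- q))\<^sup>2" for M \<theta>
      using mult_mono[OF e_bound[of M \<theta>] abs_cos_le_one[of "real j * \<theta>"]] by (simp add: abs_mult)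
    show "(\<lambda>M. e M \<theta> * cos (real j * \<theta>)) \<longlonglongrightarrow> h \<theta> * cos (real j * \<theta>)" for \<theta>
      by (intro tendsto_intros lim)
  qed
  \<comment> \<open>The truncation is a finite sum over j \<le> N, so convergence of each
    coefficient suffices. The bound \<open>?B\<close> does not depend on \<open>M\<close> and
    therefore passes to the limit.\<close>
  then have "(\<lambda>M. \<bar>e M \<theta> - cos_trunc N (e M) \<theta>\<bar>) \<longlonglongrightarrow> \<bar>h \<theta> - cos_trunc N h \<theta>\<bar>"
    unfolding cos_trunc_def by (intro tendsto_intros lim)
  moreover have "\<bar>e M \<theta> - cos_trunc N (e M) \<theta>\<bar> \<le> ?B" for M
  proof -
    have "\<bar>e M \<theta> - cos_trunc N (e M) \<theta>\<bar> \<le> (\<Sum>i | i \<in> ?I M \<and> N < d i. \<bar>w i\<bar>)"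
      unfolding e_def by (rule cos_trunc_error_cos_sum) simp
    also have "\<dots> \<le> 2 * 2 powr q * (\<Sum>m<M. \<bar>a m\<bar> * (t\<^sup>2) ^ m) * t ^ (N + 1) / (1 - t)"
      using sum_far_pairs_le[OF t, of a "2 powr q" M N] abs_gbinomial_le_two_powr[OF q]
      by (simp add: w_def d_def a_def case_prod_unfold mem_Times_iff)
    also have "\<dots> \<le> ?B"
      using t sum_abs_gbinomial_le[OF q t2, of M]
      by (intro divide_right_mono mult_right_mono mult_left_mono) (auto simp: a_def)
    finally show ?thesis .
  qed
  ultimately show ?thesis by (intro LIMSEQ_le_const2) auto
qed

section \<open>Traces of powers and polynomials of a matrix\<close>

lemma mat_trace_mult:
  fixes X Y :: "'a :: semiring_0 Matrix.mat"
  assumes "X \<in> carrier_mat n m" "Y \<in> carrier_mat m n"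
  shows "mat_trace (X * Y) = (\<Sum>i<n. \<Sum>j<m. X $$ (i, j) * Y $$ (j, i))"
  using assms by (auto simp: mat_trace_def Matrix.scalar_prod_def lessThan_atLeast0 intro!: sum.cong)

lemma mat_trace_mult_commute:
  fixes X Y :: "'a :: comm_semiring_0 Matrix.mat"
  assumes "X \<in> carrier_mat n m" "Y \<in> carrier_mat m n"
  shows "mat_trace (X * Y) = mat_trace (Y * X)"
  unfolding mat_trace_mult[OF assms] mat_trace_mult[OF assms(2,1)]
  by (subst sum.swap) (simp add: mult.commute)

lemma mat_trace_similar:
  fixes A :: "'a :: comm_ring_1 Matrix.mat"
  assumes "similar_mat_wit A B P Q"
  shows "mat_trace A = mat_trace B"
proof -
  obtain n where n: "n = dim_row A" by simp
  note w = similar_mat_witD[OF n assms]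
  have "mat_trace A = mat_trace (P * B * Q)" by (simp only: w(3))
  also have "P * B * Q = P * (B * Q)"
    using w(5-7) by (intro assoc_mult_mat[of _ n n _ n _ n])
  also have "mat_trace \<dots> = mat_trace (B * Q * P)"
    using w(5-7) by (intro mat_trace_mult_commute[of _ n n]) auto
  also have "B * Q * P = B * (Q * P)"
    using w(5-7) by (intro assoc_mult_mat[of _ n n _ n _ n])
  also have "\<dots> = B" using w(2,5) by simp
  finally show ?thesis .
qed

lemma upper_triangular_mult_diag:
  fixes X Y :: "'a :: semiring_0 Matrix.mat"
  assumes X: "X \<in> carrier_mat n n" "upper_triangular X"
    and Y: "Y \<in> carrier_mat n n" "upper_triangular Y" and ij: "j \<le> i" "i < n"
  shows "(X * Y) $$ (i, j) = (if i = j then X $$ (i, i) * Y $$ (i, i) else 0)"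
proof -
  have "(X * Y) $$ (i, j) = (\<Sum>k = 0..<n. X $$ (i, k) * Y $$ (k, j))"
    using X Y ij by (simp add: Matrix.scalar_prod_def)
  also have "\<dots> = (\<Sum>k = 0..<n. if k = i \<and> i = j then X $$ (i, i) * Y $$ (i, i) else 0)"
  proof (rule sum.cong)
    fix k assume k: "k \<in> {0..<n}"
    \<comment> \<open>If neither strict inequality holds, then j \<le> i \<le> k \<le> j, so only k
      = i = j contributes.\<close>
    consider "k < i" | "k > j" | "k = i" "i = j" using ij by linarith
    then show "X $$ (i, k) * Y $$ (k, j) = (if k = i \<and> i = j then X $$ (i, i) * Y $$ (i, i) else 0)"
    proof cases
      case 1
      then have "X $$ (i, k) = 0" using X ij by (auto dest: upper_triangularD)
      then show ?thesis using 1 by simp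
    next
      case 2
      then have "Y $$ (k, j) = 0" using Y k by (auto dest: upper_triangularD)
      then show ?thesis using 2 by auto
    qed simp
  qed simp
  finally show ?thesis using ij by (cases "i = j") auto
qed

lemma upper_triangular_pow:
  fixes B :: "'a :: semiring_1 Matrix.mat"
  assumes "B \<in> carrier_mat n n" "upper_triangular B"
  shows "upper_triangular (B ^\<^sub>m k) \<and> (\<forall>i<n. (B ^\<^sub>m k) $$ (i, i) = (B $$ (i, i)) ^ k)"
proof (induction k)
  case 0
  then show ?case using assms by (auto simp: upper_triangular_one)
next
  case (Suc k)
  have c: "B ^\<^sub>m k \<in> carrier_mat n n" using assms(1) by (rule pow_carrier_mat)
  then have "(B ^\<^sub>m Suc k) $$ (i, j) = (if i = j then (B $$ (i, i)) ^ Suc k else 0)"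
    if "j \<le> i" "i < n" for i j
    using upper_triangular_mult_diag[OF c _ assms that] Suc that
    by (simp add: power_commutes)
  moreover have "dim_row (B ^\<^sub>m Suc k) = n" using assms by simp
  ultimately show ?case by (auto intro!: upper_triangularI)
qed

text \<open>Schur triangularisation gives a similar upper triangular matrix with diagonal
  \<open>es\<close>. Its kth power has the entries e^k on the diagonal, and the trace is invariant
  under similarity.\<close>

lemma mat_trace_pow:
  fixes A :: "'a :: conjugatable_ordered_field Matrix.mat"
  assumes A: "A \<in> carrier_mat n n" and es: "char_poly A = (\<Prod>e\<leftarrow>es. [:- e, 1:])"
  shows "mat_trace (A ^\<^sub>m k) = (\<Sum>e\<leftarrow>es. e ^ k)"
proof -
  obtain B P Q where "schur_decomposition A es = (B, P, Q)" by (cases "schur_decomposition A es")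
  note s = schur_decomposition[OF A es this]
  then have B: "B \<in> carrier_mat n n" using A similar_mat_witD2(5)[OF A] by blast
  have "mat_trace (A ^\<^sub>m k) = mat_trace (B ^\<^sub>m k)"
    using s by (intro mat_trace_similar similar_mat_wit_pow) auto
  also have "\<dots> = (\<Sum>i<n. (B $$ (i, i)) ^ k)"
    using upper_triangular_pow[OF B, of k] s B by (simp add: mat_trace_def)
  also have "\<dots> = (\<Sum>e\<leftarrow>diag_mat B. e ^ k)"
    using B by (simp add: diag_mat_def sum_list_sum_nth atLeast0LessThan)
  finally show ?thesis using s by simp
qed

lemma pow_mat_add:
  fixes A :: "'a :: semiring_1 Matrix.mat"
  assumes A: "A \<in> carrier_mat n n"
  shows "A ^\<^sub>m (k + l) = A ^\<^sub>m k * A ^\<^sub>m l"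
proof (induction l)
  case 0
  then show ?case using right_mult_one_mat[OF pow_carrier_mat[OF A]] A by simp
next
  case (Suc l)
  then show ?case
    using assoc_mult_mat[OF pow_carrier_mat[OF A] pow_carrier_mat[OF A] A] by simp
qed

text \<open>Since \<open>poly_mat\<close> is given by entries, the trace of the square expands into
  a double sum of the traces of A^(k + l). Each of these is a power sum over \<open>es\<close>, and
  the double sum recombines to the square of p(e).\<close>

lemma mat_trace_poly_mat_squared:
  fixes A :: "'a :: conjugatable_ordered_field Matrix.mat"
  assumes A: "A \<in> carrier_mat n n" and es: "char_poly A = (\<Prod>e\<leftarrow>es. [:- e, 1:])"
  shows "mat_trace (poly_mat p A ^\<^sub>m 2) = (\<Sum>e\<leftarrow>es. (poly p e)\<^sup>2)"
proof -
  let ?D = "degree p"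
  have c: "poly_mat p A \<in> carrier_mat n n" using A by (simp add: poly_mat_def)
  have pc: "A ^\<^sub>m k \<in> carrier_mat n n" for k using A by (rule pow_carrier_mat)
  have "mat_trace (poly_mat p A ^\<^sub>m 2) = mat_trace (poly_mat p A * poly_mat p A)"
    using c by (simp add: numeral_2_eq_2)
  also have "\<dots> = (\<Sum>i<n. \<Sum>j<n. (\<Sum>k\<le>?D. coeff p k * (A ^\<^sub>m k) $$ (i, j)) * (\<Sum>l\<le>?D. coeff p l * (A ^\<^sub>m l) $$ (j, i)))"
    unfolding mat_trace_mult[OF c c] using A by (simp add: poly_mat_def)
  also have "\<dots> = (\<Sum>i<n. \<Sum>j<n. \<Sum>k\<le>?D. \<Sum>l\<le>?D. coeff p k * coeff p l * ((A ^\<^sub>m k) $$ (i, j) * (A ^\<^sub>m l) $$ (j, i)))"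
    by (simp add: sum_product mult_ac)
  also have "\<dots> = (\<Sum>k\<le>?D. \<Sum>l\<le>?D. \<Sum>i<n. \<Sum>j<n. coeff p k * coeff p l * ((A ^\<^sub>m k) $$ (i, j) * (A ^\<^sub>m l) $$ (j, i)))"
    by (simp only: sum.swap[of _ "{..<n}" "{..?D}"])
  also have "\<dots> = (\<Sum>k\<le>?D. \<Sum>l\<le>?D. coeff p k * coeff p l * mat_trace (A ^\<^sub>m k * A ^\<^sub>m l))"
    by (simp add: mat_trace_mult[OF pc pc] sum_distrib_left)
  also have "\<dots> = (\<Sum>k\<le>?D. \<Sum>l\<le>?D. coeff p k * coeff p l * (\<Sum>e\<leftarrow>es. e ^ k * e ^ l))"
    using A by (simp add: mat_trace_pow[OF A es] power_add flip: pow_mat_add[OF A])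
  also have "\<dots> = (\<Sum>e\<leftarrow>es. \<Sum>k\<le>?D. \<Sum>l\<le>?D. coeff p k * coeff p l * (e ^ k * e ^ l))"
    by (induction es) (simp_all add: distrib_left sum.distrib)
  also have "\<dots> = (\<Sum>e\<leftarrow>es. (poly p e)\<^sup>2)"
    by (simp add: poly_altdef power2_eq_square sum_product mult_ac)
  finally show ?thesis .
qed

section \<open>Real spectrum of symmetric matrices\<close>

text \<open>For an eigenvector v the form \<open>S\<close> = v^* A v is fixed by conjugation because
  A is real and symmetric, and it equals \<open>\<mu>\<close> times |v|^2 > 0.\<close>

lemma eigenvalue_symmetric_real:
  fixes A :: "real Matrix.mat"
  assumes A: "A \<in> carrier_mat n n" and sym: "transpose_mat A = A"
    and ev: "eigenvalue (map_mat complex_of_real A) \<mu>"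
  shows "\<mu> \<in> \<real>"
proof -
  let ?C = "map_mat complex_of_real A"
  obtain v where v: "v \<in> carrier_vec n" "v \<noteq> 0\<^sub>v n" "?C *\<^sub>v v = \<mu> \<cdot>\<^sub>v v"
    using ev A by (auto simp: eigenvalue_def eigenvector_def)
  define S where "S = (\<Sum>i<n. \<Sum>j<n. cnj (v $ i) * of_real (A $$ (i, j)) * v $ j)"
  define r where "r = (\<Sum>i<n. (cmod (v $ i))\<^sup>2)"
  have symij: "A $$ (i, j) = A $$ (j, i)" if "i < n" "j < n" for i j
    using that A sym by (metis carrier_matD index_transpose_mat(1))
  have "cnj S = (\<Sum>i<n. \<Sum>j<n. cnj (v $ j) * of_real (A $$ (j, i)) * v $ i)"
    unfolding S_def by (auto simp: symij intro!: sum.cong)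
  also have "\<dots> = S" unfolding S_def by (rule sum.swap)
  finally have "S \<in> \<real>" by (simp add: Reals_cnj_iff)
  have "S = (\<Sum>i<n. cnj (v $ i) * (?C *\<^sub>v v) $ i)"
    using A v(1) by (simp add: S_def Matrix.scalar_prod_def sum_distrib_left lessThan_atLeast0 mult_ac)
  also have "\<dots> = \<mu> * of_real r"
    using v(1) unfolding v(3)
    by (simp add: r_def sum_distrib_left complex_norm_square mult_ac flip: of_real_power)
  finally have S: "S = \<mu> * of_real r" .
  obtain i where "i < n" "v $ i \<noteq> 0" using v(1,2) by (metis carrier_vecD eq_vecI index_zero_vec)
  then have "r > 0" unfolding r_def by (intro sum_pos2[of _ i]) auto
  then have "\<mu> = S / of_real r" using S by simp
  then show ?thesis using \<open>S \<in> \<real>\<close> by simp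
qed

text \<open>The factorisation exists over the complex numbers, its roots are eigenvalues and hence
  real, and it descends because the embedding of real into complex polynomials is injective.\<close>

lemma char_poly_symmetric_splits:
  fixes A :: "real Matrix.mat"
  assumes A: "A \<in> carrier_mat n n" and sym: "transpose_mat A = A"
  obtains es where "char_poly A = (\<Prod>e\<leftarrow>es. [:- e, 1:])"
proof -
  let ?C = "map_mat complex_of_real A"
  have C: "?C \<in> carrier_mat n n" using A by simp
  obtain as where as: "char_poly ?C = (\<Prod>a\<leftarrow>as. [:- a, 1:])"
    using char_poly_factorized[OF C] by blast
  have "a \<in> \<real>" if "a \<in> set as" for a
  proof (rule eigenvalue_symmetric_real[OF A sym])
    show "eigenvalue ?C a"
      unfolding eigenvalue_root_char_poly[OF C] as using that
      by (auto simp: poly_prod_list prod_list_zero_iff)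
  qed
  then have re: "map (complex_of_real \<circ> Re) as = as" by (intro map_idI) auto
  interpret of_real_poly: map_poly_inj_idom_hom complex_of_real ..
  have "map_poly complex_of_real (char_poly A) = (\<Prod>a\<leftarrow>map (complex_of_real \<circ> Re) as. [:- a, 1:])"
    using as by (simp add: re of_real_hom.char_poly_hom[OF A])
  also have "\<dots> = map_poly complex_of_real (\<Prod>a\<leftarrow>map Re as. [:- a, 1:])"
    by (simp add: of_real_poly.hom_prod_list o_def)
  finally have "char_poly A = (\<Prod>a\<leftarrow>map Re as. [:- a, 1:])"
    by (simp only: of_real_poly.eq_iff)
  then show ?thesis by (rule that)
qed

text \<open>Identifies the multiset of eigenvalues in \<open>schatten_norm\<close> with the list
  \<open>es\<close> used for the traces.\<close>

lemma proots_prod_linear: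
  fixes es :: "'a :: idom list"
  shows "proots (\<Prod>e\<leftarrow>es. [:- e, 1:]) = mset es"
proof (induction es)
  case (Cons e es)
  have "(\<Prod>e\<leftarrow>es. [:- e, 1:]) \<noteq> 0" by (auto simp: prod_list_zero_iff)
  then have "proots ([:- e, 1:] * (\<Prod>e\<leftarrow>es. [:- e, 1:])) = {#e#} + mset es"
    by (subst proots_mult) (simp_all add: Cons)
  then show ?case by (simp del: mult_pCons_left)
qed simp

section \<open>Chebyshev approximation of powers\<close>

lemma cheb_coeff_eq_cos_coeff:
  "cheb_coeff g a b j = cos_coeff (\<lambda>\<theta>. g ((b - a) / 2 * cos \<theta> + (b + a) / 2)) j"
  by (simp add: cheb_coeff_def cos_coeff_def)

text \<open>The affine map inside \<open>cheb_approx\<close> sends this point back to cos \<theta>,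
  and there T_j takes the value cos(j \<theta>), because arccos inverts cos on [0, pi].\<close>

lemma poly_cheb_approx:
  assumes "a < b" and \<theta>: "\<theta> \<in> {0..pi}"
  shows "poly (cheb_approx N g a b) ((b - a) / 2 * cos \<theta> + (b + a) / 2) =
    cos_trunc N (\<lambda>\<theta>. g ((b - a) / 2 * cos \<theta> + (b + a) / 2)) \<theta>"
proof -
  let ?x = "(b - a) / 2 * cos \<theta> + (b + a) / 2"
  have lin: "poly [: - ((b + a) / (b - a)), 2 / (b - a) :] ?x = cos \<theta>"
  proof -
    have "2 * ?x = (b - a) * cos \<theta> + (b + a)" by (simp add: field_simps)
    then have "2 / (b - a) * ?x = cos \<theta> + (b + a) / (b - a)"
      using assms(1) by (simp add: add_divide_distrib)
    then show ?thesis by (simp add: mult.commute)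
  qed
  have T: "poly (cheb_poly j) (cos \<theta>) = cos (real j * \<theta>)" for j
    using \<theta> by (simp add: poly_cheb_poly arccos_cos)
  have "poly (cheb_approx N g a b) ((b - a) / 2 * cos \<theta> + (b + a) / 2) =
     cheb_coeff g a b 0 + (\<Sum>j = 1..N. cheb_coeff g a b j * cos (real j * \<theta>))"
    unfolding cheb_approx_def poly_add poly_sum poly_smult poly_pcompose lin T by simp
  also have "\<dots> = (\<Sum>j\<le>N. cheb_coeff g a b j * cos (real j * \<theta>))"
    by (simp add: sum.atLeast1_atMost_eq sum.atMost_shift)
  finally show ?thesis by (simp add: cos_trunc_def cheb_coeff_eq_cos_coeff)
qed

lemma cos_trunc_scale: "cos_trunc N (\<lambda>\<theta>. c * h \<theta>) \<theta> = c * cos_trunc N h \<theta>"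
  by (simp add: cos_trunc_def cos_coeff_def mult.assoc sum_distrib_left mult.left_commute)

lemma cheb_approx_powr_error:
  fixes a b q x \<kappa> :: real
  assumes ab: "0 < a" "a < b" and q: "0 \<le> q" and x: "x \<in> {a..b}"
    and \<kappa>: "\<kappa> = sqrt (b / a)"
  shows "\<bar>poly (cheb_approx N (\<lambda>x. x powr q) a b) x - x powr q\<bar> \<le>
    a powr q * ((\<kappa>\<^sup>2 + 1) powr q * \<kappa> powr (2 * q) * (\<kappa> - 1) * ((\<kappa> - 1) / (\<kappa> + 1)) ^ N)"
proof -
  have \<kappa>1: "1 < \<kappa>" using ab by (simp add: \<kappa>)
  have b: "b = a * \<kappa>\<^sup>2" using ab by (simp add: \<kappa>)
  define t where "t = (\<kappa> - 1) / (\<kappa> + 1)"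
  define h where "h = (\<lambda>\<theta>. (1 + 2 * t * cos \<theta> + t\<^sup>2) powr q)"
  have t: "0 \<le> t" "t < 1" using \<kappa>1 by (auto simp: t_def)
  \<comment> \<open>This is a / (1 - t)^2, since 1 - t = 2 / (\<open>\<kappa>\<close> + 1).\<close>
  define c where "c = a * (\<kappa> + 1)\<^sup>2 / 4"
  have c: "0 \<le> c" using ab by (simp add: c_def)
  have map: "(b - a) / 2 * cos \<theta> + (b + a) / 2 = c * (1 + 2 * t * cos \<theta> + t\<^sup>2)" for \<theta>
  proof -
    have t\<kappa>: "(\<kappa> + 1) * t = \<kappa> - 1" using \<kappa>1 by (simp add: t_def)
    have "c * (1 + 2 * t * cos \<theta> + t\<^sup>2) =
        a / 4 * ((\<kappa> + 1)\<^sup>2 + 2 * ((\<kappa> + 1) * t) * (\<kappa> + 1) * cos \<theta> + ((\<kappa> + 1) * t)\<^sup>2)"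
      by (simp add: c_def power2_eq_square algebra_simps)
    then show ?thesis unfolding t\<kappa> by (simp add: b power2_eq_square field_simps)
  qed
  have pos: "0 \<le> 1 + 2 * t * cos \<theta> + t\<^sup>2" for \<theta>
    unfolding one_add_cos_eq_sum_squares by simp
  have g: "((b - a) / 2 * cos \<theta> + (b + a) / 2) powr q = c powr q * h \<theta>" for \<theta>
    unfolding map h_def using c pos by (simp add: powr_mult)
  define \<theta> where "\<theta> = arccos ((2 * x - (b + a)) / (b - a))"
  have y: "-1 \<le> (2 * x - (b + a)) / (b - a)" "(2 * x - (b + a)) / (b - a) \<le> 1"
    using ab x by (auto simp: field_simps)
  have \<theta>: "\<theta> \<in> {0..pi}" using y by (simp add: \<theta>_def arccos_lbound arccos_ubound)
  have xc: "x = (b - a) / 2 * cos \<theta> + (b + a) / 2"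
    using y ab by (simp add: \<theta>_def field_simps)
  have "poly (cheb_approx N (\<lambda>x. x powr q) a b) x = c powr q * cos_trunc N h \<theta>"
    unfolding xc poly_cheb_approx[OF ab(2) \<theta>] g cos_trunc_scale ..
  moreover have "x powr q = c powr q * h \<theta>"
    unfolding xc g ..
  ultimately have "\<bar>poly (cheb_approx N (\<lambda>x. x powr q) a b) x - x powr q\<bar> =
      c powr q * \<bar>h \<theta> - cos_trunc N h \<theta>\<bar>"
    by (simp add: abs_mult abs_minus_commute flip: right_diff_distrib)
  also have "\<dots> \<le> c powr q * (2 * 2 powr q * (1 - t\<^sup>2) powr (- q) * t ^ (N + 1) / (1 - t))"
    using cos_trunc_error[OF q t \<theta>, of N] by (intro mult_left_mono) (auto simp: h_def)
  \<comment> \<open>One of the N + 1 factors t is split off to form 2 t / (1 - t), which is exactly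
    \<open>\<kappa>\<close> - 1; everything raised to the power q is collected in one base.\<close>
  also have "\<dots> = (c * 2 / (1 - t\<^sup>2)) powr q * (2 * t / (1 - t)) * t ^ N"
    using c t by (simp add: powr_mult powr_divide powr_minus_divide power_le_one mult_ac)
  also have "2 * t / (1 - t) = \<kappa> - 1"
    using \<kappa>1 by (simp add: t_def field_simps)
  \<comment> \<open>The base equals a (\<open>\<kappa>\<close> + 1)^4 / (8 \<open>\<kappa>\<close>).
    One square (\<open>\<kappa>\<close> + 1)^2 is bounded by 2 (\<open>\<kappa>\<close>^2 + 1), the
    other by 4 \<open>\<kappa>\<close>^3.\<close>
  also have "(c * 2 / (1 - t\<^sup>2)) powr q \<le> (a * (\<kappa>\<^sup>2 + 1) * \<kappa>\<^sup>2) powr q"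
  proof (rule powr_mono2[OF q])
    have t2: "1 - t\<^sup>2 = 4 * \<kappa> / (\<kappa> + 1)\<^sup>2"
      using \<kappa>1 by (simp add: t_def power_divide field_simps) (simp add: power2_eq_square algebra_simps)
    have "(\<kappa> + 1)\<^sup>2 \<le> 2 * (\<kappa>\<^sup>2 + 1)"
      using zero_le_power2[of "\<kappa> - 1"] by (simp add: power2_eq_square algebra_simps)
    moreover have "(\<kappa> + 1)\<^sup>2 \<le> 4 * \<kappa> ^ 3"
    proof -
      have "(\<kappa> + 1)\<^sup>2 \<le> (2 * \<kappa>)\<^sup>2" using \<kappa>1 by (intro power_mono) auto
      also have "\<dots> \<le> 4 * \<kappa> ^ 3"
        using \<kappa>1 power_increasing[of 2 3 \<kappa>] by (simp add: power_mult_distrib)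
      finally show ?thesis .
    qed
    ultimately have "(\<kappa> + 1)\<^sup>2 * (\<kappa> + 1)\<^sup>2 \<le> 2 * (\<kappa>\<^sup>2 + 1) * (4 * \<kappa> ^ 3)"
      by (intro mult_mono) auto
    then have "a * ((\<kappa> + 1)\<^sup>2 * (\<kappa> + 1)\<^sup>2) \<le> a * (2 * (\<kappa>\<^sup>2 + 1) * (4 * \<kappa> ^ 3))"
      using ab by simp
    then show "c * 2 / (1 - t\<^sup>2) \<le> a * (\<kappa>\<^sup>2 + 1) * \<kappa>\<^sup>2"
      unfolding t2 c_def using \<kappa>1 by (simp add: field_simps power2_eq_square power3_eq_cube)
    show "0 \<le> c * 2 / (1 - t\<^sup>2)" unfolding t2 using c \<kappa>1 by simp
  qed
  also have "(a * (\<kappa>\<^sup>2 + 1) * \<kappa>\<^sup>2) powr q = a powr q * ((\<kappa>\<^sup>2 + 1) powr q * \<kappa> powr (2 * q))"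
    using ab \<kappa>1 by (simp add: powr_mult powr_powr flip: powr_numeral)
  finally show ?thesis
    using t \<kappa>1 by (simp add: t_def mult_ac mult_right_mono)
qed


section \<open>From the error at each eigenvalue to the trace\<close>

theorem proposition7:
  fixes A :: "real Matrix.mat" and n N :: nat and a b \<epsilon> p q \<kappa> :: real
    and \<psi> :: "real poly" and \<phi>A :: "real Matrix.mat"
  assumes "A \<in> carrier_mat n n"
    and "symmetric_positive_definite A"
    and "\<And>\<mu>. eigenvalue A \<mu> \<Longrightarrow> \<mu> \<in> {a..b}"
    and "0 < a" and "a < b"
    and "0 < \<epsilon>" and "\<epsilon> \<le> 1"
    and "p \<ge> 1" and "q = p / 2" and "\<kappa> = sqrt (b / a)"
    and "\<psi> = cheb_approx N (\<lambda>x. x powr (p / 2)) a b"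
    and "\<phi>A = poly_mat \<psi> A ^\<^sub>m 2"
    and "real N \<ge>
      ln (4 / \<epsilon> * (\<kappa>\<^sup>2 + 1) powr q * (\<kappa> - 1) * (\<kappa> powr p + sqrt (\<epsilon> / 2 + \<kappa> powr (2 * p))))
      / ln ((\<kappa> + 1) / (\<kappa> - 1))"
  shows "\<bar>mat_trace \<phi>A - schatten_norm p A powr p\<bar> \<le> \<epsilon> / 2 * schatten_norm p A powr p"
proof -
  define t where "t = (\<kappa> - 1) / (\<kappa> + 1)"
  \<comment> \<open>The bound of \<open>cheb_approx_powr_error\<close> divided by a^q, with 2 q
    written as p.\<close>
  define E where "E = (\<kappa>\<^sup>2 + 1) powr q * \<kappa> powr p * (\<kappa> - 1) * t ^ N"
  have q: "0 \<le> q" "p = 2 * q" using assms by auto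
  have \<kappa>1: "1 < \<kappa>" using assms by simp
  have t: "0 < t" "t < 1" using \<kappa>1 by (auto simp: t_def)
  have E0: "0 \<le> E" using t \<kappa>1 by (simp add: E_def)
  have E: "E \<le> \<epsilon> / 8"
  proof -
    define L where "L = 4 / \<epsilon> * (\<kappa>\<^sup>2 + 1) powr q * (\<kappa> - 1) * (\<kappa> powr p + sqrt (\<epsilon> / 2 + \<kappa> powr (2 * p)))"
    \<comment> \<open>The square root is at least \<open>\<kappa> powr p\<close>, so the last factor
      of \<open>L\<close> is at least twice that; the constant 4 becomes 8, the source of \<epsilon>
      / 8.\<close>
    have "sqrt ((\<kappa> powr p)\<^sup>2) \<le> sqrt (\<epsilon> / 2 + \<kappa> powr (2 * p))"
      using assms(6) \<kappa>1 by (simp add: power2_eq_square flip: powr_add)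
    then have "4 / \<epsilon> * (\<kappa>\<^sup>2 + 1) powr q * (\<kappa> - 1) * (\<kappa> powr p + \<kappa> powr p) \<le> L"
      unfolding L_def using assms(6) \<kappa>1 by (intro mult_left_mono add_mono) auto
    then have L1: "8 / \<epsilon> * ((\<kappa>\<^sup>2 + 1) powr q * \<kappa> powr p * (\<kappa> - 1)) \<le> L"
      by (simp add: mult_ac)
    have "0 < 8 / \<epsilon> * ((\<kappa>\<^sup>2 + 1) powr q * \<kappa> powr p * (\<kappa> - 1))"
    proof -
      have "\<kappa>\<^sup>2 + 1 \<noteq> 0" using zero_le_power2[of \<kappa>] by linarith
      then show ?thesis using assms(6) \<kappa>1 by (intro mult_pos_pos divide_pos_pos) auto
    qed
    then have L0: "0 < L" using L1 by (rule less_le_trans)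
    have t_inv: "1 / t = (\<kappa> + 1) / (\<kappa> - 1)" by (simp add: t_def)
    have "ln L / ln (1 / t) \<le> real N"
      using assms(13) unfolding L_def t_inv .
    \<comment> \<open>Multiplying out keeps the inequality because 1 / t > 1 has a positive
      logarithm.\<close>
    then have "ln L \<le> real N * ln (1 / t)"
      using t by (subst (asm) pos_divide_le_eq) auto
    also have "\<dots> = ln ((1 / t) ^ N)" using t by (simp add: ln_realpow)
    finally have "L \<le> (1 / t) ^ N" using L0 t by simp
    with L1 have "8 / \<epsilon> * ((\<kappa>\<^sup>2 + 1) powr q * \<kappa> powr p * (\<kappa> - 1)) \<le> (1 / t) ^ N"
      by (rule order_trans)
    then show ?thesis using t assms(6) by (simp add: E_def field_simps)
  qed
  have pointwise: "\<bar>(poly \<psi> e)\<^sup>2 - e powr p\<bar> \<le> \<epsilon> / 2 * e powr p" if e: "e \<in> {a..b}" for e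
  proof -
    define d where "d = poly \<psi> e - e powr q"
    have "\<bar>d\<bar> \<le> a powr q * E"
      using cheb_approx_powr_error[OF assms(4,5) q(1) e assms(10), of N]
      unfolding d_def E_def t_def assms(11) q(2) by simp
    \<comment> \<open>Since a \<le> e, the absolute error becomes an error relative to e^q.\<close>
    also have "\<dots> \<le> e powr q * (\<epsilon> / 8)"
      using assms(4) e q E E0 by (intro mult_mono powr_mono2) auto
    finally have d: "\<bar>d\<bar> \<le> e powr q * (\<epsilon> / 8)" .
    have ep: "e powr p = e powr q * e powr q" by (simp add: q flip: powr_add)
    \<comment> \<open>Squaring e^q + d leaves d (2 e^q + d). From \<epsilon> \<le> 1 follows |d|
      \<le> e^q, so the second factor is at most 3 e^q and the relative error at most 3 \<epsilon> /
      8.\<close>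
    have "(poly \<psi> e)\<^sup>2 - e powr p = d * (2 * e powr q + d)"
      unfolding ep d_def by (simp add: power2_eq_square algebra_simps)
    also have "\<bar>\<dots>\<bar> \<le> (e powr q * (\<epsilon> / 8)) * (3 * e powr q)"
      unfolding abs_mult
    proof (intro mult_mono d)
      have "e powr q * (\<epsilon> / 8) \<le> e powr q" using assms(7) by (intro mult_left_le) auto
      then show "\<bar>2 * e powr q + d\<bar> \<le> 3 * e powr q"
        using d powr_ge_zero[of e q] by linarith
    qed (use assms(6) in auto)
    also have "\<dots> \<le> \<epsilon> / 2 * e powr p"
      using assms(6) by (simp add: ep field_simps)
    finally show ?thesis .
  qed
  have sym: "transpose_mat A = A"
    using assms(2) by (simp add: symmetric_positive_definite_def)
  obtain es where es: "char_poly A = (\<Prod>e\<leftarrow>es. [:- e, 1:])"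
    by (rule char_poly_symmetric_splits[OF assms(1) sym])
  have es_ab: "e \<in> {a..b}" if "e \<in> set es" for e
    using that by (intro assms(3))
      (auto simp: eigenvalue_root_char_poly[OF assms(1)] es poly_prod_list prod_list_zero_iff)
  have norm: "schatten_norm p A powr p = (\<Sum>e\<leftarrow>es. e powr p)"
  proof -
    have "(\<Sum>\<mu>\<in>#proots (char_poly A). \<mu> powr p) = (\<Sum>e\<leftarrow>es. e powr p)"
      by (simp add: es proots_prod_linear flip: sum_mset_sum_list)
    \<comment> \<open>The exponents 1 / p and p cancel to \<open>powr 1\<close>, which is the
      identity on nonnegative reals.\<close>
    moreover have "0 \<le> (\<Sum>e\<leftarrow>es. e powr p)" by (intro sum_list_nonneg) auto
    ultimately show ?thesis using assms(8) by (simp add: schatten_norm_def powr_powr)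
  qed
  have "mat_trace \<phi>A - schatten_norm p A powr p = (\<Sum>e\<leftarrow>es. (poly \<psi> e)\<^sup>2 - e powr p)"
    by (simp add: assms(12) mat_trace_poly_mat_squared[OF assms(1) es] norm sum_list_subtractf)
  also have "\<bar>\<dots>\<bar> \<le> (\<Sum>e\<leftarrow>es. \<bar>(poly \<psi> e)\<^sup>2 - e powr p\<bar>)"
    using sum_list_abs[of "map (\<lambda>e. (poly \<psi> e)\<^sup>2 - e powr p) es"] by (simp add: o_def)
  also have "\<dots> \<le> (\<Sum>e\<leftarrow>es. \<epsilon> / 2 * e powr p)"
    by (intro sum_list_mono pointwise es_ab)
  also have "\<dots> = \<epsilon> / 2 * schatten_norm p A powr p"
    unfolding norm by (rule sum_list_const_mult)
  finally show ?thesis .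
qed

end
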